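(* Let $r\ge 0$. If every multiplier from $H^1(\mathbb{T})$ to $L^2(\mathbb{T})$ is a multiplier from $L\log^{r}L(\mathbb{T})$ to $L^2(\mathbb{T})$, then $r\ge 1/2$.
   Context: $\mathbb{T}$ is the one-dimensional torus (circle group), with dual group $\mathbb{Z}$. $H^1(\mathbb{T})$ is the (real) periodic Hardy space: the space of all $f\in L^1(\mathbb{T})$ whose periodic Hilbert transform $H(f)$ (the conjugate function, with Fourier multiplier $-i\,\mathrm{sgn}(n)$) belongs to $L^1(\mathbb{T})$. For $r\ge 0$, $L\log^{r}L(\mathbb{T})$ is the space of measurable $f$ on $\mathbb{T}$ with $\int_{\mathbb{T}}|f|\log^{r}(1+|f|)\,d\theta<\infty$ (for $r=0$ this is $L^1(\mathbb{T})$). For a subspace $X\subset L^1(\mathbb{T})$, a bounded sequence $m=(m(n))_{n\in\mathbb{Z}}\in\ell^\infty(\mathbb{Z})$ is called a multiplier from $X$ to $L^2(\mathbb{T})$ if $\sum_{n\in\mathbb{Z}}|m(n)\widehat{f}(n)|^2<\infty$ for every $f\in X$. *)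

theory Defs
  imports "HOL-Analysis.Analysis" "HOL-Probability.Probability_Measure"
begin

text \<open>The torus is realised as the unit circle in the complex plane, carrying its normalised
  Haar (arc length) measure.  Functions on the torus are total functions on the complex plane
  whose values off the circle never matter.\<close>

definition torus :: "complex measure" where
  "torus = distr (uniform_measure lborel {0..<2*pi}) (restrict_space borel (sphere 0 1)) cis"

lemma measurable_cis_torus:
  "cis \<in> measurable (uniform_measure lborel {0..<2*pi}) (restrict_space borel (sphere 0 1))"
proof -
  have "cis \<in> borel_measurable borel"
    by (intro borel_measurable_continuous_onI continuous_intros)
  then show ?thesis
    by (auto intro!: measurable_restrict_space2)
qed

lemma space_torus: "space torus = sphere 0 1"
  by (simp add: torus_def space_restrict_space)

lemma integral_torus:
  fixes f :: "complex \<Rightarrow> complex"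
  assumes "f \<in> borel_measurable torus"
  shows "(LINT z|torus. f z) = (LINT t:{0..<2*pi}|lborel. f (cis t)) / (2 * pi)"
proof -
  have c: "cis \<in> measurable lborel (restrict_space borel (sphere 0 1))"
    using measurable_cis_torus by simp
  have f: "f \<in> borel_measurable (restrict_space borel (sphere 0 1))"
    using assms by (simp add: torus_def)
  have m: "(\<lambda>t. f (cis t)) \<in> borel_measurable lborel"
    by (rule measurable_compose[OF c f])
  have u: "uniform_measure lborel {0..<2*pi} =
      density lborel (\<lambda>t. ennreal (indicator {0..<2*pi} t / (2*pi)))"
    unfolding uniform_measure_def
    by (intro density_cong)
      (auto simp: indicator_def divide_ennreal[symmetric] simp flip: ennreal_1 split: if_splits)
  have "(LINT z|torus. f z) = (LINT t|uniform_measure lborel {0..<2*pi}. f (cis t))"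
    unfolding torus_def by (rule integral_distr[OF measurable_cis_torus f])
  also have "\<dots> = (LINT t|lborel. (indicator {0..<2*pi} t / (2*pi)) *\<^sub>R f (cis t))"
    unfolding u using m by (intro integral_density) auto
  also have "\<dots> = (LINT t|lborel. (indicator {0..<2*pi} t *\<^sub>R f (cis t)) / (2*pi))"
    by (intro Bochner_Integration.integral_cong) (auto simp: indicator_def scaleR_conv_of_real)
  finally show ?thesis
    by (simp add: set_lebesgue_integral_def)
qed

lemma prob_space_torus: "prob_space torus"
proof -
  have "prob_space (uniform_measure lborel {0..<2*pi})"
    by (intro prob_space_uniform_measure) auto
  then show ?thesis
    unfolding torus_def by (rule prob_space.prob_space_distr[OF _ measurable_cis_torus])
qed

definition L1_torus :: "(complex \<Rightarrow> complex) set" where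
  "L1_torus = {f. integrable torus f}"

definition fourier_coeff :: "(complex \<Rightarrow> complex) \<Rightarrow> int \<Rightarrow> complex" where
  "fourier_coeff f n = (LINT z|torus. f z * z powi (- n))"

text \<open>For integrable \<open>f\<close> the Hilbert transform is a priori only a distribution, given by its
  Fourier multiplier.  That it belongs to \<open>L1_torus\<close> means that some integrable function \<open>g\<close>
  has these Fourier coefficients.\<close>

definition is_hilbert_transform :: "(complex \<Rightarrow> complex) \<Rightarrow> (complex \<Rightarrow> complex) \<Rightarrow> bool" where
  "is_hilbert_transform f g \<longleftrightarrow>
     (\<forall>n. fourier_coeff g n = - \<i> * of_int (sgn n) * fourier_coeff f n)"

definition hardy_H1 :: "(complex \<Rightarrow> complex) set" where
  "hardy_H1 = {f \<in> L1_torus. \<exists>g \<in> L1_torus. is_hilbert_transform f g}"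

text \<open>The convention \<open>0 powr 0 = 0\<close> is harmless below, because of the factor \<open>norm (f z)\<close>.\<close>

definition LlogL :: "real \<Rightarrow> (complex \<Rightarrow> complex) set" where
  "LlogL r = {f \<in> borel_measurable torus.
     integrable torus (\<lambda>z. norm (f z) * ln (1 + norm (f z)) powr r)}"

lemma LlogL_subset_L1:
  assumes "r \<ge> 0"
  shows "LlogL r \<subseteq> L1_torus"
proof
  fix f assume "f \<in> LlogL r"
  then have f: "f \<in> borel_measurable torus"
    and i: "integrable torus (\<lambda>z. norm (f z) * ln (1 + norm (f z)) powr r)"
    by (auto simp: LlogL_def)
  interpret prob_space torus by (rule prob_space_torus)
  have "norm (f z) \<le> exp 1 + norm (f z) * ln (1 + norm (f z)) powr r" for z
  proof (cases "exp 1 \<le> norm (f z)")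
    case True
    then have "1 + norm (f z) \<ge> exp 1" by simp
    then have "1 \<le> ln (1 + norm (f z))"
      by (subst ln_ge_iff) (auto simp: add_pos_nonneg)
    then have "1 \<le> ln (1 + norm (f z)) powr r"
      using assms by (rule ge_one_powr_ge_zero)
    then have "norm (f z) * 1 \<le> norm (f z) * ln (1 + norm (f z)) powr r"
      by (intro mult_left_mono) auto
    moreover have "0 < exp (1::real)" by simp
    ultimately show ?thesis by linarith
  next
    case False
    moreover have "0 \<le> norm (f z) * ln (1 + norm (f z)) powr r" by simp
    ultimately show ?thesis by linarith
  qed
  then have bound: "norm (f z) \<le> norm (exp 1 + norm (f z) * ln (1 + norm (f z)) powr r)" for z
    unfolding real_norm_def by (rule order_trans[OF _ abs_ge_self])
  have "integrable torus (\<lambda>z. exp 1 + norm (f z) * ln (1 + norm (f z)) powr r)"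
    using i by (intro Bochner_Integration.integrable_add) simp_all
  then have "integrable torus f"
    using f by (rule Bochner_Integration.integrable_bound) (rule AE_I2, rule bound)
  then show "f \<in> L1_torus"
    by (simp add: L1_torus_def)
qed

definition L2_multiplier :: "(complex \<Rightarrow> complex) set \<Rightarrow> (int \<Rightarrow> complex) \<Rightarrow> bool" where
  "L2_multiplier X m \<longleftrightarrow> bounded (range m) \<and>
     (\<forall>f\<in>X. (\<lambda>n. (norm (m n * fourier_coeff f n))\<^sup>2) summable_on UNIV)"

end

theory Submission
  imports Defs "HOL-Complex_Analysis.Complex_Analysis"
    "HOL-Computational_Algebra.Fundamental_Theorem_Algebra"
begin

text \<open>The witness is the indicator \<open>m\<close> of the lacunary set \<open>{4 ^ k}\<close>.

  That \<open>m\<close> maps \<open>H\<^sup>1\<close> to \<open>L\<^sup>2\<close> is Paley's inequality.  If \<open>g\<close> is the Hilbert transform of \<open>f\<close>, then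
  \<open>f + \<i> g\<close> has no negative frequencies, so its Fejer means are polynomials.  A polynomial \<open>p\<close>
  without zeros on the circle factors there as \<open>p = G H\<close> with \<open>G\<close> and \<open>H\<close> holomorphic near the closed
  disc and \<open>|G|\<^sup>2 = |H|\<^sup>2 = |p|\<close> on the circle: take for \<open>G\<close> a square root of the polynomial obtained
  by reflecting the zeros of \<open>p\<close> out of the disc.  In the Cauchy product for the coefficient of
  index \<open>4 ^ k\<close> one of the two indices lies in \<open>[4 ^ k / 2, 4 ^ k]\<close>; these blocks are disjoint, so
  Cauchy-Schwarz and Bessel's inequality bound the sum of the squared coefficients by a multiple of
  the squared \<open>L\<^sup>1\<close> norm of \<open>p\<close>.

  For \<open>r < 1/2\<close>, the Fejer kernel \<open>K\<^sub>n\<close> of order \<open>2 * 4 ^ n\<close> has \<open>L\<^sup>1\<close> norm one, logarithm at most of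
  order \<open>n\<close>, and coefficients at least \<open>1/2\<close> at \<open>4 ^ k\<close> for \<open>k \<le> n\<close>.  Hence \<open>n powr (-r) * K\<^sub>n\<close>
  is bounded in \<open>L log\<^sup>r L\<close>, whereas its squared lacunary coefficients add up to at least
  \<open>n powr (1 - 2 * r) / 4\<close>.  A convergent superposition of such kernels with \<open>n\<close> growing
  rapidly is the counterexample.\<close>

section \<open>Fourier coefficients on the torus\<close>

interpretation torus: prob_space torus by (rule prob_space_torus)

lemma AE_torus_norm: "AE z in torus. norm z = 1"
  by (rule AE_I2) (simp add: space_torus)

lemma measurable_torus_continuous:
  fixes f :: "complex \<Rightarrow> 'b::topological_space"
  assumes "continuous_on (sphere 0 1) f"
  shows "f \<in> borel_measurable torus"
proof -
  have "sets torus = sets (restrict_space borel (sphere 0 1))"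
    by (simp add: torus_def)
  then show ?thesis
    using borel_measurable_continuous_on_restrict[OF assms] measurable_cong_sets by blast
qed

lemma integrable_torus_continuous:
  fixes f :: "complex \<Rightarrow> 'b::{banach, second_countable_topology}"
  assumes "continuous_on (sphere 0 1) f"
  shows "integrable torus f"
proof -
  have "bounded (f ` sphere 0 1)"
    by (intro compact_imp_bounded compact_continuous_image assms compact_sphere)
  then obtain B where "\<forall>z\<in>sphere 0 1. norm (f z) \<le> B"
    by (auto simp: bounded_iff simp del: mem_sphere)
  then show ?thesis
    by (intro torus.integrable_const_bound[where B = B] AE_I2 measurable_torus_continuous assms)
      (auto simp: space_torus)
qed

lemma integral_torus_power_int:
  "(LINT z|torus. z powi n) = (if n = 0 then 1 else 0)"
proof (cases "n = 0")
  case True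
  then show ?thesis using torus.prob_space by simp
next
  case False
  have "continuous_on (sphere 0 1) (\<lambda>z::complex. z powi n)"
    by (intro continuous_intros) auto
  then have "(LINT z|torus. z powi n) = (LINT t:{0..<2*pi}|lborel. cis t powi n) / (2 * pi)"
    by (intro integral_torus measurable_torus_continuous)
  \<comment> \<open>Adding the endpoint, a null set, gives the closed interval that the fundamental
    theorem of calculus requires.\<close>
  also have "(LINT t:{0..<2*pi}|lborel. cis t powi n) = (LINT t:{0..2*pi}|lborel. cis (of_int n * t))"
    unfolding cis_power_int set_lebesgue_integral_def
  proof (rule integral_cong_AE)
    have [measurable]: "(\<lambda>t. cis (of_int n * t)) \<in> borel_measurable borel"
      by (intro borel_measurable_continuous_onI continuous_intros)
    show "(\<lambda>t. indicat_real {0..<2*pi} t *\<^sub>R cis (of_int n * t)) \<in> borel_measurable lborel"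
      and "(\<lambda>t. indicat_real {0..2*pi} t *\<^sub>R cis (of_int n * t)) \<in> borel_measurable lborel"
      by measurable
    show "AE t in lborel. indicat_real {0..<2*pi} t *\<^sub>R cis (of_int n * t) =
        indicat_real {0..2*pi} t *\<^sub>R cis (of_int n * t)"
      by (rule AE_I[of _ _ "{2*pi}"]) (auto simp: indicator_def)
  qed
  also have "\<dots> = cis (of_int n * (2*pi)) / (\<i> * n) - cis (of_int n * 0) / (\<i> * n)"
    unfolding set_lebesgue_integral_def
  proof (rule integral_FTC_atLeastAtMost)
    fix x :: real
    show "((\<lambda>t. cis (of_int n * t) / (\<i> * n)) has_vector_derivative cis (of_int n * x))
        (at x within {0..2 * pi})"
      unfolding cis_conv_exp using False
      by (auto intro!: derivative_eq_intros has_vector_derivative_real_field simp: field_simps)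
  qed (auto intro!: continuous_intros)
  also have "\<dots> = 0"
    using cis_multiple_2pi[of "of_int n"] by (simp add: mult.commute)
  finally show ?thesis using False by simp
qed

lemma integrable_torus_mult_powi:
  assumes "integrable torus f"
  shows "integrable torus (\<lambda>z. f z * z powi n)"
proof (rule Bochner_Integration.integrable_bound[OF assms])
  have "(\<lambda>z::complex. z powi n) \<in> borel_measurable torus"
    by (intro measurable_torus_continuous continuous_intros) auto
  then show "(\<lambda>z. f z * z powi n) \<in> borel_measurable torus"
    using assms by auto
  show "AE z in torus. norm (f z * z powi n) \<le> norm (f z)"
    using AE_torus_norm by eventually_elim (auto simp: norm_mult norm_power_int)
qed

lemma fourier_coeff_add_mult:
  assumes "integrable torus f" "integrable torus g"
  shows "fourier_coeff (\<lambda>z. f z + c * g z) n = fourier_coeff f n + c * fourier_coeff g n"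
proof -
  have "fourier_coeff (\<lambda>z. f z + c * g z) n =
      (LINT z|torus. f z * z powi (- n) + c * (g z * z powi (- n)))"
    by (simp add: fourier_coeff_def algebra_simps)
  also have "\<dots> = fourier_coeff f n + c * fourier_coeff g n"
    unfolding fourier_coeff_def
    by (subst Bochner_Integration.integral_add) (auto intro!: integrable_torus_mult_powi assms)
  finally show ?thesis .
qed

text \<open>Absolute summability of the coefficients permits termwise integration, and orthogonality
  of the powers of \<open>z\<close> isolates one term. Polynomials are covered as series with
  finitely many nonzero coefficients.\<close>

lemma fourier_coeff_series:
  assumes "summable (\<lambda>k. norm (a k))"
    and "\<And>z. norm z = 1 \<Longrightarrow> (\<lambda>k. a k * z ^ k) sums f z"
  shows "fourier_coeff f (int n) = a n"
proof -
  have "fourier_coeff f (int n) = (LINT z|torus. (\<Sum>k. a k * z powi (int k - int n)))"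
    unfolding fourier_coeff_def
  proof (intro Bochner_Integration.integral_cong refl)
    fix z assume "z \<in> space torus"
    then have z: "norm z = 1" "z \<noteq> 0" by (auto simp: space_torus)
    show "f z * z powi (- int n) = (\<Sum>k. a k * z powi (int k - int n))"
      using sums_mult2[OF assms(2)[OF z(1)], of "z powi (- int n)"] z(2)
      by (auto simp: sums_iff power_int_diff power_int_minus field_simps)
  qed
  also have "\<dots> = (\<Sum>k. LINT z|torus. a k * z powi (int k - int n))"
  proof (rule integral_suminf)
    fix k
    show "integrable torus (\<lambda>z. a k * z powi (int k - int n))"
      by (intro integrable_torus_continuous continuous_intros) auto
  next
    show "AE z in torus. summable (\<lambda>k. norm (a k * z powi (int k - int n)))"
      using AE_torus_norm by eventually_elim (use assms(1) in \<open>auto simp: norm_mult norm_power_int\<close>)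
    have "(LINT z|torus. norm (a k * z powi (int k - int n))) = (LINT z|torus. norm (a k))" for k
      by (intro Bochner_Integration.integral_cong)
        (auto simp: space_torus norm_mult norm_power_int)
    then show "summable (\<lambda>k. LINT z|torus. norm (a k * z powi (int k - int n)))"
      using assms(1) torus.prob_space by simp
  qed
  also have "\<dots> = (\<Sum>k. if k = n then a n else 0)"
    by (intro suminf_cong) (auto simp: integral_torus_power_int)
  also have "\<dots> = a n"
    using sums_unique[OF sums_single[of n "\<lambda>k. a n"]] by simp
  finally show ?thesis .
qed

lemma cnj_eq_inverse: "norm z = 1 \<Longrightarrow> cnj z = inverse z"
  by (metis complex_norm_square inverse_unique of_real_1 one_power2)

text \<open>With \<open>s\<close> the part of the Fourier series of \<open>f\<close> indexed by
  \<open>A\<close>, expand the integral of \<open>|f - s|^2\<close>, which is nonnegative. The inner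
  products of \<open>f\<close> with \<open>s\<close> and of \<open>s\<close> with itself are both
  the left-hand side.\<close>

lemma bessel_inequality:
  assumes "continuous_on (sphere 0 1) f" "finite A"
  shows "(\<Sum>n\<in>A. (norm (fourier_coeff f (int n)))\<^sup>2) \<le> (LINT z|torus. (norm (f z))\<^sup>2)"
proof -
  define c where "c n = fourier_coeff f (int n)" for n
  define s where "s z = (\<Sum>n\<in>A. c n * z ^ n)" for z
  have cs: "continuous_on (sphere 0 1) s"
    unfolding s_def by (intro continuous_intros)
  have fc_s: "fourier_coeff s (int n) = (if n \<in> A then c n else 0)" for n
  proof (rule fourier_coeff_series)
    show "summable (\<lambda>k. norm (if k \<in> A then c k else 0))"
      by (rule summable_finite[OF assms(2)]) auto
    show "(\<lambda>k. (if k \<in> A then c k else 0) * z ^ k) sums s z" for z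
      unfolding s_def using sums_finite[OF assms(2), of "\<lambda>k. (if k \<in> A then c k else 0) * z ^ k"]
      by simp
  qed
  \<comment> \<open>A general \<open>g\<close> serves both inner products, \<open>g = f\<close> and
    \<open>g = s\<close>.\<close>
  have inner: "(LINT z|torus. g z * cnj (s z)) = (\<Sum>n\<in>A. fourier_coeff g (int n) * cnj (c n))"
    if g: "continuous_on (sphere 0 1) g" for g
  proof -
    have "(LINT z|torus. g z * cnj (s z)) =
        (LINT z|torus. (\<Sum>n\<in>A. (g z * z powi (- int n)) * cnj (c n)))"
    proof (intro Bochner_Integration.integral_cong refl)
      fix z assume "z \<in> space torus"
      then have "cnj z = inverse z"
        by (simp add: space_torus cnj_eq_inverse)
      then show "g z * cnj (s z) = (\<Sum>n\<in>A. (g z * z powi (- int n)) * cnj (c n))"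
        by (simp add: s_def sum_distrib_left power_int_minus power_inverse algebra_simps)
    qed
    also have "\<dots> = (\<Sum>n\<in>A. fourier_coeff g (int n) * cnj (c n))"
      unfolding fourier_coeff_def
      by (subst Bochner_Integration.integral_sum)
        (simp_all add: integrable_torus_mult_powi integrable_torus_continuous g)
    finally show ?thesis .
  qed
  have fs: "(LINT z|torus. f z * cnj (s z)) = (\<Sum>n\<in>A. (norm (c n))\<^sup>2)"
    by (simp add: inner[OF assms(1)] c_def[symmetric] complex_norm_square[symmetric])
  have ss: "(LINT z|torus. s z * cnj (s z)) = (\<Sum>n\<in>A. (norm (c n))\<^sup>2)"
    unfolding inner[OF cs] by (simp add: fc_s complex_norm_square del: of_real_power)
  have ss': "(LINT z|torus. (norm (s z))\<^sup>2) = (\<Sum>n\<in>A. (norm (c n))\<^sup>2)"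
  proof -
    have "complex_of_real (LINT z|torus. (norm (s z))\<^sup>2) = (LINT z|torus. s z * cnj (s z))"
      by (subst integral_complex_of_real[symmetric]) (simp add: complex_norm_square[symmetric])
    also have "\<dots> = complex_of_real (\<Sum>n\<in>A. (norm (c n))\<^sup>2)"
      unfolding ss by simp
    finally show ?thesis by (simp only: of_real_eq_iff)
  qed
  have int_fs: "integrable torus (\<lambda>z. f z * cnj (s z))"
    by (intro integrable_torus_continuous continuous_intros assms cs)
  have "0 \<le> (LINT z|torus. (norm (f z - s z))\<^sup>2)"
    by simp
  also have "\<dots> = (LINT z|torus. (norm (f z))\<^sup>2 - 2 * Re (f z * cnj (s z)) + (norm (s z))\<^sup>2)"
    by (intro Bochner_Integration.integral_cong refl)
      (simp only: cmod_power2, simp add: power2_eq_square algebra_simps)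
  also have "\<dots> = (LINT z|torus. (norm (f z))\<^sup>2) - 2 * Re (LINT z|torus. f z * cnj (s z))
      + (LINT z|torus. (norm (s z))\<^sup>2)"
    by (subst Bochner_Integration.integral_add Bochner_Integration.integral_diff;
        (intro integrable_torus_continuous continuous_intros assms cs)?)+
      (simp only: integral_mult_right_zero integral_Re[OF int_fs])
  also have "\<dots> = (LINT z|torus. (norm (f z))\<^sup>2) - (\<Sum>n\<in>A. (norm (c n))\<^sup>2)"
    unfolding fs ss' by simp
  finally show ?thesis by (simp add: c_def)
qed

section \<open>Paley's inequality\<close>

text \<open>Of the indices \<open>i\<close> and \<open>4 ^ k - i\<close> one lies in the block
  \<open>I k\<close>, the upper half of \<open>{..4 ^ k}\<close>. Cauchy-Schwarz on each half of the
  sum keeps one sequence on the block and bounds the other globally. The blocks are disjoint, so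
  summing over \<open>k\<close> costs only \<open>A\<close> or \<open>B\<close> again. The two
  halves contribute \<open>2 * A * B\<close> each.\<close>

lemma lacunary_convolution_bound:
  fixes a b :: "nat \<Rightarrow> real"
  assumes nonneg: "\<And>i. a i \<ge> 0" "\<And>i. b i \<ge> 0"
    and A: "\<And>I. finite I \<Longrightarrow> (\<Sum>i\<in>I. (a i)\<^sup>2) \<le> A"
    and B: "\<And>I. finite I \<Longrightarrow> (\<Sum>i\<in>I. (b i)\<^sup>2) \<le> B"
  shows "(\<Sum>k<M. (\<Sum>i\<le>4 ^ k. a i * b (4 ^ k - i))\<^sup>2) \<le> 4 * A * B"
proof -
  define I :: "nat \<Rightarrow> nat set" where "I k = {i. i \<le> 4 ^ k \<and> 4 ^ k \<le> 2 * i}" for k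
  have fin [simp]: "finite (I k)" for k
    by (rule finite_subset[of _ "{..4 ^ k}"]) (auto simp: I_def)
  have AB: "A \<ge> 0" "B \<ge> 0" using A[of "{}"] B[of "{}"] by auto
  have I_less: "I k \<inter> I l = {}" if "k < l" for k l
  proof -
    \<comment> \<open>The ratio 4 makes \<open>I l\<close> start at \<open>2 * 4 ^ k\<close> or
      later, strictly beyond \<open>I k\<close>; with ratio 2, neighbouring blocks would share an
      endpoint.\<close>
    have "(4::nat) * 4 ^ k \<le> 4 ^ l"
      using that power_increasing[of "Suc k" l "4::nat"] by simp
    moreover have "(4::nat) ^ k > 0" by simp
    ultimately have "\<not> (i \<le> 4 ^ k \<and> 4 ^ l \<le> 2 * i)" for i :: nat by linarith
    then show ?thesis by (auto simp: I_def)
  qed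
  have disj: "I k \<inter> I l = {}" if "k \<noteq> l" for k l
    using I_less[of k l] I_less[of l k] that by (cases k l rule: linorder_cases) auto
  have blocks: "(\<Sum>k<M. \<Sum>i\<in>I k. (c i)\<^sup>2) \<le> C"
    if "\<And>J. finite J \<Longrightarrow> (\<Sum>i\<in>J. (c i)\<^sup>2) \<le> C" for c :: "nat \<Rightarrow> real" and C
  proof -
    have "(\<Sum>k<M. \<Sum>i\<in>I k. (c i)\<^sup>2) = (\<Sum>i\<in>(\<Union>k<M. I k). (c i)\<^sup>2)"
      by (rule sum.UNION_disjoint[symmetric]) (auto simp: disj)
    also have "\<dots> \<le> C" by (rule that) auto
    finally show ?thesis .
  qed
  have half: "(\<Sum>i\<in>I k. c i * d (4 ^ k - i))\<^sup>2 \<le> (\<Sum>i\<in>I k. (c i)\<^sup>2) * D"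
    if "\<And>J. finite J \<Longrightarrow> (\<Sum>i\<in>J. (d i)\<^sup>2) \<le> D" for c d :: "nat \<Rightarrow> real" and D k
  proof -
    have "inj_on (\<lambda>i. 4 ^ k - i) (I k)"
      by (auto simp: inj_on_def I_def)
    then have "(\<Sum>i\<in>I k. (d (4 ^ k - i))\<^sup>2) = (\<Sum>j\<in>(\<lambda>i. 4 ^ k - i) ` I k. (d j)\<^sup>2)"
      by (simp add: sum.reindex)
    also have "\<dots> \<le> D" by (rule that) simp
    finally have "(\<Sum>i\<in>I k. (c i)\<^sup>2) * (\<Sum>i\<in>I k. (d (4 ^ k - i))\<^sup>2) \<le> (\<Sum>i\<in>I k. (c i)\<^sup>2) * D"
      by (intro mult_left_mono sum_nonneg) auto
    then show ?thesis
      using Cauchy_Schwarz_ineq_sum[of c "\<lambda>i. d (4 ^ k - i)" "I k"] by linarith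
  qed
  have "(\<Sum>i\<le>4 ^ k. a i * b (4 ^ k - i))\<^sup>2 \<le>
      2 * B * (\<Sum>i\<in>I k. (a i)\<^sup>2) + 2 * A * (\<Sum>i\<in>I k. (b i)\<^sup>2)" for k
  proof -
    let ?n = "4 ^ k :: nat"
    let ?S = "\<Sum>i\<in>I k. a i * b (?n - i)" and ?T = "\<Sum>i\<in>I k. b i * a (?n - i)"
    have inj: "inj_on (\<lambda>i. ?n - i) (I k)"
      by (auto simp: inj_on_def I_def)
    \<comment> \<open>The block and its reflection may overlap at the midpoint; as all terms are
      nonnegative, counting that index twice only enlarges the bound.\<close>
    have "{..?n} \<subseteq> I k \<union> (\<lambda>i. ?n - i) ` I k"
    proof
      fix i assume "i \<in> {..?n}"
      then have "i \<in> I k \<or> (?n - i \<in> I k \<and> i = ?n - (?n - i))"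
        by (auto simp: I_def)
      then show "i \<in> I k \<union> (\<lambda>i. ?n - i) ` I k" by blast
    qed
    then have "(\<Sum>i\<le>?n. a i * b (?n - i)) \<le> (\<Sum>i\<in>I k \<union> (\<lambda>i. ?n - i) ` I k. a i * b (?n - i))"
      by (intro sum_mono2) (auto simp: nonneg)
    also have "\<dots> \<le> ?S + (\<Sum>i\<in>(\<lambda>i. ?n - i) ` I k. a i * b (?n - i))"
      by (subst sum.union_inter[symmetric]) (auto intro!: sum_nonneg simp: nonneg)
    also have "(\<Sum>i\<in>(\<lambda>i. ?n - i) ` I k. a i * b (?n - i)) = ?T"
      by (subst sum.reindex[OF inj]) (auto intro!: sum.cong simp: I_def mult.commute)
    finally have "(\<Sum>i\<le>?n. a i * b (?n - i)) \<le> ?S + ?T" .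
    then have "(\<Sum>i\<le>?n. a i * b (?n - i))\<^sup>2 \<le> (?S + ?T)\<^sup>2"
      by (intro power_mono sum_nonneg) (auto simp: nonneg)
    also have "\<dots> \<le> 2 * ?S\<^sup>2 + 2 * ?T\<^sup>2"
      using sum_squares_bound[of ?S ?T] by (simp add: power2_sum)
    also have "\<dots> \<le> 2 * ((\<Sum>i\<in>I k. (a i)\<^sup>2) * B) + 2 * ((\<Sum>i\<in>I k. (b i)\<^sup>2) * A)"
      using half[of b B a k] half[of a A b k] A B by (intro add_mono mult_left_mono) auto
    finally show ?thesis by (simp add: mult_ac)
  qed
  then have "(\<Sum>k<M. (\<Sum>i\<le>4 ^ k. a i * b (4 ^ k - i))\<^sup>2) \<le>
      (\<Sum>k<M. 2 * B * (\<Sum>i\<in>I k. (a i)\<^sup>2) + 2 * A * (\<Sum>i\<in>I k. (b i)\<^sup>2))"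
    by (intro sum_mono)
  also have "\<dots> = 2 * B * (\<Sum>k<M. \<Sum>i\<in>I k. (a i)\<^sup>2) + 2 * A * (\<Sum>k<M. \<Sum>i\<in>I k. (b i)\<^sup>2)"
    by (simp add: sum.distrib sum_distrib_left)
  also have "\<dots> \<le> 2 * B * A + 2 * A * B"
    using blocks[OF A] blocks[OF B] AB by (intro add_mono mult_left_mono) auto
  finally show ?thesis by simp
qed

text \<open>The Taylor series converges at a point \<open>x\<close> of modulus strictly between 1
  and \<open>R\<close>, which forces absolute convergence on the unit circle.\<close>

lemma holomorphic_ball_power_series:
  assumes "G holomorphic_on ball 0 R" "R > 1"
  obtains a where "summable (\<lambda>k. norm (a k))"
    "\<And>z. norm z = 1 \<Longrightarrow> (\<lambda>k. a k * z ^ k) sums G z"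
proof
  define a where "a k = (deriv ^^ k) G 0 / fact k" for k
  have s: "(\<lambda>k. a k * z ^ k) sums G z" if "norm z < R" for z
    using holomorphic_power_series[OF assms(1), of z] that by (simp add: a_def)
  show "(\<lambda>k. a k * z ^ k) sums G z" if "norm z = 1" for z
    using s that assms(2) by simp
  define x where "x = complex_of_real ((1 + R) / 2)"
  have x: "norm x = (1 + R) / 2"
    unfolding x_def norm_of_real using assms(2) by simp
  then have "summable (\<lambda>k. a k * x ^ k)"
    using s[of x] assms(2) by (auto simp: sums_iff)
  then show "summable (\<lambda>k. norm (a k))"
    using powser_insidea[of a x 1] x assms(2) by simp
qed

text \<open>The coefficients of the product are Cauchy products of the two Taylor sequences. After
  passing to moduli, Bessel's inequality supplies the two square-sum bounds of the convolution
  estimate.\<close>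

lemma paley_holomorphic_product:
  assumes G: "G holomorphic_on ball 0 R" and H: "H holomorphic_on ball 0 R" and R: "R > 1"
  shows "(\<Sum>k<M. (norm (fourier_coeff (\<lambda>z. G z * H z) (int (4 ^ k))))\<^sup>2)
    \<le> 4 * (LINT z|torus. (norm (G z))\<^sup>2) * (LINT z|torus. (norm (H z))\<^sup>2)"
proof -
  obtain a where a: "summable (\<lambda>k. norm (a k))" "\<And>z. norm z = 1 \<Longrightarrow> (\<lambda>k. a k * z ^ k) sums G z"
    using holomorphic_ball_power_series[OF G R] by blast
  obtain b where b: "summable (\<lambda>k. norm (b k))" "\<And>z. norm z = 1 \<Longrightarrow> (\<lambda>k. b k * z ^ k) sums H z"
    using holomorphic_ball_power_series[OF H R] by blast
  have cont: "continuous_on (sphere 0 1) G" "continuous_on (sphere 0 1) H"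
    by (rule continuous_on_subset[OF holomorphic_on_imp_continuous_on[OF G]]
          continuous_on_subset[OF holomorphic_on_imp_continuous_on[OF H]]; use R in auto)+
  define c where "c k = (\<Sum>i\<le>k. a i * b (k - i))" for k
  have fc: "fourier_coeff (\<lambda>z. G z * H z) (int n) = c n" for n
  proof (rule fourier_coeff_series)
    show "summable (\<lambda>k. norm (c k))"
    proof (rule summable_comparison_test')
      show "summable (\<lambda>k. \<Sum>i\<le>k. norm (a i) * norm (b (k - i)))"
        using a b by (intro summable_Cauchy_product) auto
      show "norm (norm (c k)) \<le> (\<Sum>i\<le>k. norm (a i) * norm (b (k - i)))" for k
        by (auto simp: c_def norm_mult[symmetric] intro: norm_sum)
    qed
  next
    fix z :: complex assume z: "norm z = 1"
    have "(\<lambda>k. \<Sum>i\<le>k. (a i * z ^ i) * (b (k - i) * z ^ (k - i))) sums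
        ((\<Sum>k. a k * z ^ k) * (\<Sum>k. b k * z ^ k))"
      using a b z by (intro Cauchy_product_sums) (auto simp: norm_mult norm_power)
    also have "(\<lambda>k. \<Sum>i\<le>k. (a i * z ^ i) * (b (k - i) * z ^ (k - i))) = (\<lambda>k. c k * z ^ k)"
      unfolding c_def sum_distrib_right
      by (intro ext sum.cong) (simp_all add: mult_ac flip: power_add)
    also have "(\<Sum>k. a k * z ^ k) * (\<Sum>k. b k * z ^ k) = G z * H z"
      using a(2)[OF z] b(2)[OF z] by (simp add: sums_iff)
    finally show "(\<lambda>k. c k * z ^ k) sums (G z * H z)" .
  qed
  have "(\<Sum>k<M. (norm (fourier_coeff (\<lambda>z. G z * H z) (int (4 ^ k))))\<^sup>2)
      \<le> (\<Sum>k<M. (\<Sum>i\<le>4 ^ k. norm (a i) * norm (b (4 ^ k - i)))\<^sup>2)"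
    unfolding fc by (intro sum_mono power_mono) (auto simp: c_def norm_mult[symmetric] intro: norm_sum)
  also have "\<dots> \<le> 4 * (LINT z|torus. (norm (G z))\<^sup>2) * (LINT z|torus. (norm (H z))\<^sup>2)"
  proof (rule lacunary_convolution_bound)
    fix J :: "nat set" assume "finite J"
    then show "(\<Sum>i\<in>J. (norm (a i))\<^sup>2) \<le> (LINT z|torus. (norm (G z))\<^sup>2)"
      and "(\<Sum>i\<in>J. (norm (b i))\<^sup>2) \<le> (LINT z|torus. (norm (H z))\<^sup>2)"
      using bessel_inequality[OF cont(1)] bessel_inequality[OF cont(2)]
      by (simp_all add: fourier_coeff_series[OF a] fourier_coeff_series[OF b])
  qed auto
  finally show ?thesis .
qed

section \<open>Reflection of zeros and Paley's inequality for polynomials\<close>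

text \<open>Roots are treated one at a time: a factor \<open>z - w\<close> with \<open>w\<close> in
  the disc is replaced by \<open>1 - cnj w * z\<close>, which has the same modulus on the circle
  and, unless it is constant, its zero at the reflected point outside the closed disc. The
  polynomial \<open>q\<close> is thus the outer part of \<open>p\<close>.\<close>

lemma poly_reflect_roots:
  fixes p :: "complex poly"
  assumes "\<And>z. norm z = 1 \<Longrightarrow> poly p z \<noteq> 0"
  shows "\<exists>q R. R > 1 \<and> (\<forall>z. norm z < R \<longrightarrow> poly q z \<noteq> 0) \<and>
    (\<forall>z. norm z = 1 \<longrightarrow> norm (poly q z) = norm (poly p z))"
  using assms
proof (induction "degree p" arbitrary: p)
  case 0
  then obtain c where "p = [:c:]" by (metis degree_eq_zeroE)
  with "0.prems"[of 1] show ?case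
    by (intro exI[of _ p] exI[of _ 2]) auto
next
  case (Suc d)
  obtain w where w: "poly p w = 0"
    using alg_closed_imp_poly_has_root[of p] Suc.hyps(2) by auto
  then obtain p' where p': "p = [:-w, 1:] * p'"
    unfolding poly_eq_0_iff_dvd by (elim dvdE)
  have "p' \<noteq> 0" using Suc.hyps(2) p' by auto
  then have "degree p = Suc (degree p')"
    unfolding p' by (subst degree_mult_eq) auto
  with Suc.hyps(2) have d: "d = degree p'" by simp
  have "poly p' z \<noteq> 0" if "norm z = 1" for z
    using Suc.prems[OF that] p' by auto
  from Suc.hyps(1)[OF d this] obtain q R where q: "R > 1"
      "\<And>z. norm z < R \<Longrightarrow> poly q z \<noteq> 0"
      "\<And>z. norm z = 1 \<Longrightarrow> norm (poly q z) = norm (poly p' z)"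
    by blast
  have w1: "norm w \<noteq> 1" using Suc.prems w by blast
  have lin: "poly ([:a, b:] * r) z = (a + b * z) * poly r z" for a b z :: complex and r
    by (simp add: algebra_simps)
  show ?case
  proof (cases "norm w > 1")
    case True
    have "poly ([:-w, 1:] * q) z \<noteq> 0" if "norm z < min R (norm w)" for z
      using that q(2)[of z] unfolding lin by auto
    moreover have "norm (poly ([:-w, 1:] * q) z) = norm (poly p z)" if "norm z = 1" for z
      using q(3)[OF that] unfolding p' lin by (simp add: norm_mult)
    ultimately show ?thesis
      using True q(1) by (intro exI[of _ "[:-w, 1:] * q"] exI[of _ "min R (norm w)"]) simp
  next
    case False
    with w1 have w2: "norm w < 1" by simp
    \<comment> \<open>The reflected zero has modulus \<open>1 / norm w\<close>, so any
      \<open>S\<close> between 1 and this value is safe. For \<open>w = 0\<close> the new factor is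
      constant and has no zero.\<close>
    obtain S where S: "S > 1" "S * norm w < 1"
    proof (cases "w = 0")
      case True
      then show ?thesis using that[of 2] by simp
    next
      case False
      then obtain S where "1 < S" "S < inverse (norm w)"
        using w2 dense[of 1 "inverse (norm w)"] by (auto simp: one_less_inverse_iff)
      then show ?thesis using that[of S] False by (simp add: field_simps)
    qed
    have nz: "1 - cnj w * z \<noteq> 0" if "norm z < S" for z
    proof
      assume "1 - cnj w * z = 0"
      then have "norm w * norm z = 1"
        by (metis complex_mod_cnj eq_iff_diff_eq_0 norm_mult norm_one)
      moreover have "norm w * norm z \<le> norm w * S"
        using that by (intro mult_left_mono) auto
      ultimately show False using S by (simp add: mult.commute)
    qed
    have refl: "norm (1 - cnj w * z) = norm (z - w)" if "norm z = 1" for z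
    proof -
      have "1 = z * cnj z" using that by (simp add: complex_norm_square[symmetric])
      then have "1 - cnj w * z = z * cnj (z - w)" by (simp add: algebra_simps)
      then show ?thesis using that by (simp add: norm_mult del: complex_cnj_diff)
    qed
    have "poly ([:1, - cnj w:] * q) z \<noteq> 0" if "norm z < min R S" for z
      using that q(2)[of z] nz[of z] unfolding lin by auto
    moreover have "norm (poly ([:1, - cnj w:] * q) z) = norm (poly p z)" if "norm z = 1" for z
      using q(3)[OF that] refl[OF that] unfolding p' lin by (simp add: norm_mult)
    ultimately show ?thesis
      using S(1) q(1) by (intro exI[of _ "[:1, - cnj w:] * q"] exI[of _ "min R S"]) simp
  qed
qed

text \<open>Sharing \<open>|p|\<close> equally between two factors turns both squared
  \<open>L^2\<close> norms into the \<open>L^1\<close> norm of \<open>p\<close>, so the product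
  estimate becomes quadratic in that norm.\<close>

lemma paley_poly_nonvanishing:
  fixes p :: "complex poly"
  assumes nz: "\<And>z. norm z = 1 \<Longrightarrow> poly p z \<noteq> 0"
  shows "(\<Sum>k<M. (norm (coeff p (4 ^ k)))\<^sup>2) \<le> 4 * (LINT z|torus. norm (poly p z))\<^sup>2"
proof -
  obtain q R where R: "R > 1" and q: "\<And>z. norm z < R \<Longrightarrow> poly q z \<noteq> 0"
      "\<And>z. norm z = 1 \<Longrightarrow> norm (poly q z) = norm (poly p z)"
    using poly_reflect_roots[of p] nz by auto
  have "poly q holomorphic_on ball 0 R"
    unfolding poly_altdef by (intro holomorphic_intros)
  then obtain g where g: "g holomorphic_on ball 0 R" "\<And>z. z \<in> ball 0 R \<Longrightarrow> exp (g z) = poly q z"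
    by (rule holomorphic_logarithm_exists[of "ball 0 R" "poly q" 0, OF convex_ball open_ball])
      (use q R in auto)
  define G where "G z = exp (g z / 2)" for z
  \<comment> \<open>The exponential \<open>G\<close> never vanishes, so \<open>H\<close> is
    holomorphic; it carries all zeros that \<open>p\<close> has in the ball.\<close>
  define H where "H z = poly p z / G z" for z
  have hol: "G holomorphic_on ball 0 R" "H holomorphic_on ball 0 R"
    unfolding H_def G_def poly_altdef using g(1) by (intro holomorphic_intros; simp)+
  have G2: "(norm (G z))\<^sup>2 = norm (poly p z)" if "norm z = 1" for z
  proof -
    have "(G z)\<^sup>2 = exp (g z)" by (simp add: G_def exp_double[symmetric])
    also have "\<dots> = poly q z" using g(2) that R by simp
    finally show ?thesis using q(2)[OF that] by (metis norm_power)
  qed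
  have H2: "(norm (H z))\<^sup>2 = norm (poly p z)" if "norm z = 1" for z
    using G2[OF that] nz[OF that]
    by (simp add: H_def norm_divide power_divide power2_eq_square)
  have coeff: "fourier_coeff (\<lambda>z. G z * H z) (int n) = coeff p n" for n
  proof (rule fourier_coeff_series)
    show "summable (\<lambda>k. norm (coeff p k))"
      by (rule summable_finite[of "{..degree p}"]) (auto simp: coeff_eq_0)
    show "(\<lambda>k. coeff p k * z ^ k) sums (G z * H z)" for z
      using sums_finite[of "{..degree p}" "\<lambda>k. coeff p k * z ^ k"]
      by (simp add: H_def G_def poly_altdef coeff_eq_0)
  qed
  have norms: "(LINT z|torus. (norm (G z))\<^sup>2) = (LINT z|torus. norm (poly p z))"
      "(LINT z|torus. (norm (H z))\<^sup>2) = (LINT z|torus. norm (poly p z))"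
    by (intro Bochner_Integration.integral_cong; simp add: space_torus G2 H2)+
  show ?thesis
    using paley_holomorphic_product[OF hol R, of M] unfolding coeff norms
    by (simp add: power2_eq_square mult.assoc)
qed

text \<open>The nonvanishing case holds for the dilates of \<open>p\<close> by
  \<open>\<rho> i\<close> with \<open>i\<close> large, and both sides of the inequality converge as
  \<open>\<rho> i\<close> tends to 1.\<close>

lemma paley_poly:
  fixes p :: "complex poly"
  shows "(\<Sum>k<M. (norm (coeff p (4 ^ k)))\<^sup>2) \<le> 4 * (LINT z|torus. norm (poly p z))\<^sup>2"
proof (cases "p = 0")
  case False
  \<comment> \<open>Dilations by \<open>\<rho> i\<close> move the zeros of \<open>p\<close> off the circle for all but finitely many \<open>i\<close>.\<close>
  define \<rho> :: "nat \<Rightarrow> real" where "\<rho> i = 1 - 1 / (real i + 2)" for i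
  have \<rho>: "0 < \<rho> i" "\<rho> i < 1" for i
    by (auto simp: \<rho>_def)
  have lim: "\<rho> \<longlonglongrightarrow> 1"
    unfolding \<rho>_def by real_asymp
  have "inj \<rho>" by (auto simp: inj_def \<rho>_def)
  define B where "B = {i. \<exists>z. norm z = 1 \<and> poly p (of_real (\<rho> i) * z) = 0}"
  have "\<rho> ` B \<subseteq> norm ` {w. poly p w = 0}"
  proof
    fix x assume "x \<in> \<rho> ` B"
    then obtain i z where "x = \<rho> i" "norm z = 1" "poly p (of_real (\<rho> i) * z) = 0"
      by (auto simp: B_def)
    then show "x \<in> norm ` {w. poly p w = 0}"
      using \<rho>(1)[of i] by (intro image_eqI[of _ _ "of_real (\<rho> i) * z"]) (auto simp: norm_mult)
  qed
  then have "finite (\<rho> ` B)"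
    using poly_roots_finite[OF False] finite_surj by blast
  then have "finite B"
    using \<open>inj \<rho>\<close> by (meson finite_imageD inj_on_subset subset_UNIV)
  then have "\<forall>\<^sub>F i in sequentially. i \<notin> B"
    by (simp add: eventually_cofinite flip: cofinite_eq_sequentially)
  then have ev: "\<forall>\<^sub>F i in sequentially. (\<Sum>k<M. (norm (of_real (\<rho> i) ^ 4 ^ k * coeff p (4 ^ k)))\<^sup>2) \<le>
      4 * (LINT z|torus. norm (poly p (of_real (\<rho> i) * z)))\<^sup>2"
  proof eventually_elim
    case (elim i)
    have "poly (pcompose p [:0, of_real (\<rho> i):]) z \<noteq> 0" if "norm z = 1" for z
      using elim that by (auto simp: B_def poly_pcompose mult.commute)
    from paley_poly_nonvanishing[OF this, of M] show ?case
      by (simp add: poly_pcompose coeff_pcompose_linear mult.commute)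
  qed
  \<comment> \<open>Since \<open>\<rho> i < 1\<close>, this constant dominates every dilate on the
    circle, as dominated convergence requires.\<close>
  define C where "C = (\<Sum>k\<le>degree p. norm (coeff p k))"
  have meas: "(\<lambda>z. norm (poly p (c * z))) \<in> borel_measurable torus" for c
    by (intro measurable_torus_continuous continuous_intros)
  have "(\<lambda>i. LINT z|torus. norm (poly p (of_real (\<rho> i) * z))) \<longlonglongrightarrow> (LINT z|torus. norm (poly p z))"
  proof (rule integral_dominated_convergence[where w = "\<lambda>_. C"])
    show "AE z in torus. (\<lambda>i. norm (poly p (of_real (\<rho> i) * z))) \<longlonglongrightarrow> norm (poly p z)"
    proof (rule AE_I2)
      fix z
      have "(\<lambda>i. complex_of_real (\<rho> i) * z) \<longlonglongrightarrow> of_real 1 * z"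
        by (intro tendsto_intros lim)
      then have "(\<lambda>i. norm (poly p (of_real (\<rho> i) * z))) \<longlonglongrightarrow> norm (poly p (of_real 1 * z))"
        by (intro tendsto_norm isCont_tendsto_compose[OF poly_isCont])
      then show "(\<lambda>i. norm (poly p (of_real (\<rho> i) * z))) \<longlonglongrightarrow> norm (poly p z)" by simp
    qed
    fix i
    show "AE z in torus. norm (norm (poly p (of_real (\<rho> i) * z))) \<le> C"
      using AE_torus_norm
    proof eventually_elim
      case (elim z)
      then have "norm (of_real (\<rho> i) * z) \<le> 1" using \<rho>[of i] by (simp add: norm_mult)
      then have "norm (coeff p k * (of_real (\<rho> i) * z) ^ k) \<le> norm (coeff p k)" for k
        unfolding norm_mult[of "coeff p k"] norm_power
        by (intro mult_left_le power_le_one) auto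
      then have "norm (poly p (of_real (\<rho> i) * z)) \<le> C"
        unfolding poly_altdef C_def by (intro order_trans[OF norm_sum] sum_mono)
      then show ?case by simp
    qed
  qed (use meas meas[of 1] in auto)
  then have "(\<lambda>i. 4 * (LINT z|torus. norm (poly p (of_real (\<rho> i) * z)))\<^sup>2) \<longlonglongrightarrow>
      4 * (LINT z|torus. norm (poly p z))\<^sup>2"
    by (intro tendsto_intros)
  moreover have "(\<lambda>i. \<Sum>k<M. (norm (of_real (\<rho> i) ^ 4 ^ k * coeff p (4 ^ k)))\<^sup>2) \<longlonglongrightarrow>
      (\<Sum>k<M. (norm (of_real 1 ^ 4 ^ k * coeff p (4 ^ k)))\<^sup>2)"
    by (intro tendsto_intros lim)
  ultimately have "(\<Sum>k<M. (norm (of_real 1 ^ 4 ^ k * coeff p (4 ^ k)))\<^sup>2) \<le>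
      4 * (LINT z|torus. norm (poly p z))\<^sup>2"
    using ev by (intro tendsto_le[OF sequentially_bot])
  then show ?thesis by simp
qed simp

section \<open>The Fejer kernel and Fejer means\<close>

text \<open>On the circle this is the classical kernel with coefficients \<open>1 - |n| / N\<close>
  for \<open>|n| < N\<close>. The squared form makes it visibly real, nonnegative and
  continuous.\<close>

definition fejer_kernel :: "nat \<Rightarrow> complex \<Rightarrow> real" where
  "fejer_kernel N z = (norm (\<Sum>a<N. z ^ a))\<^sup>2 / real N"

lemma fejer_kernel_nonneg: "fejer_kernel N z \<ge> 0"
  by (simp add: fejer_kernel_def)

lemma continuous_on_fejer_kernel [continuous_intros]:
  "continuous_on S f \<Longrightarrow> continuous_on S (\<lambda>z. fejer_kernel N (f z))"
  unfolding fejer_kernel_def divide_inverse by (intro continuous_intros)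

lemma fejer_kernel_eq:
  assumes "norm z = 1"
  shows "complex_of_real (fejer_kernel N z) = (\<Sum>a<N. \<Sum>b<N. z powi (int a - int b)) / of_nat N"
proof -
  have "z \<noteq> 0" using assms by auto
  have "complex_of_real ((norm (\<Sum>a<N. z ^ a))\<^sup>2) = (\<Sum>a<N. z ^ a) * (\<Sum>b<N. inverse z ^ b)"
    by (simp add: complex_norm_square cnj_eq_inverse[OF assms] del: of_real_power)
  also have "\<dots> = (\<Sum>a<N. \<Sum>b<N. z powi (int a - int b))"
    using \<open>z \<noteq> 0\<close>
    by (simp add: sum_product power_int_diff power_inverse divide_inverse)
  finally show ?thesis by (simp add: fejer_kernel_def del: of_real_power)
qed

lemma fejer_kernel_le:
  assumes "norm z = 1"
  shows "fejer_kernel N z \<le> real N"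
proof -
  have "norm (\<Sum>a<N. z ^ a) \<le> (\<Sum>a<N. norm (z ^ a))" by (rule norm_sum)
  also have "\<dots> = real N" by (simp add: norm_power assms)
  finally have "(norm (\<Sum>a<N. z ^ a))\<^sup>2 \<le> (real N)\<^sup>2" by (intro power_mono) auto
  then have "fejer_kernel N z \<le> (real N)\<^sup>2 / real N"
    unfolding fejer_kernel_def by (intro divide_right_mono) auto
  then show ?thesis by (cases "N = 0") (simp_all add: power2_eq_square)
qed

text \<open>In the double sum for the kernel, exactly \<open>N - n\<close> pairs \<open>a\<close>,
  \<open>b\<close> satisfy \<open>a = b + n\<close>. The subtraction is on naturals, so the
  coefficient vanishes for \<open>n \<ge> N\<close>.\<close>

lemma fourier_coeff_fejer_kernel_translate:
  assumes w: "norm w = 1"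
  shows "fourier_coeff (\<lambda>z. of_real (fejer_kernel N (z * cnj w))) (int n) =
    of_real (real (N - n) / real N) * cnj w ^ n"
proof -
  have w0: "cnj w \<noteq> 0" using w by auto
  let ?c = "\<lambda>a b. cnj w powi (int a - int b) / of_nat N"
  have "fourier_coeff (\<lambda>z. of_real (fejer_kernel N (z * cnj w))) (int n) =
      (LINT z|torus. (\<Sum>a<N. \<Sum>b<N. ?c a b * z powi (int a - int b - int n)))"
    unfolding fourier_coeff_def
  proof (intro Bochner_Integration.integral_cong refl)
    fix z assume "z \<in> space torus"
    then have z: "norm z = 1" "z \<noteq> 0" by (auto simp: space_torus)
    then have "norm (z * cnj w) = 1" using w by (simp add: norm_mult)
    from fejer_kernel_eq[OF this, of N]
    have "of_real (fejer_kernel N (z * cnj w)) * z powi (- int n) =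
      (\<Sum>a<N. \<Sum>b<N. (z * cnj w) powi (int a - int b) * z powi (- int n) / of_nat N)"
      by (simp add: sum_divide_distrib sum_distrib_right)
    also have "\<dots> = (\<Sum>a<N. \<Sum>b<N. ?c a b * z powi (int a - int b - int n))"
    proof -
      have "z powi (i - int n) = z powi i * z powi (- int n)" for i
        using z(2) power_int_add[of z i "- int n"] by simp
      then show ?thesis
        by (intro sum.cong refl) (simp add: power_int_mult_distrib)
    qed
    finally show "of_real (fejer_kernel N (z * cnj w)) * z powi (- int n) =
      (\<Sum>a<N. \<Sum>b<N. ?c a b * z powi (int a - int b - int n))" .
  qed
  also have "\<dots> = (\<Sum>a<N. \<Sum>b<N. ?c a b * (if int a - int b - int n = 0 then 1 else 0))"
  proof -
    have int: "integrable torus (\<lambda>z. c * z powi m)" for c :: complex and m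
      by (intro integrable_torus_continuous continuous_intros) auto
    show ?thesis
      by (simp only: Bochner_Integration.integral_sum Bochner_Integration.integrable_sum int
          integral_mult_right_zero integral_torus_power_int)
  qed
  also have "\<dots> = (\<Sum>b<N. \<Sum>a<N. if a = b + n then cnj w ^ n / of_nat N else 0)"
    by (subst sum.swap, intro sum.cong refl) auto
  also have "\<dots> = (\<Sum>b<N. if b + n < N then cnj w ^ n / of_nat N else 0)"
    by (intro sum.cong refl) auto
  also have "\<dots> = (\<Sum>b\<in>{..<N - n}. cnj w ^ n / of_nat N)"
    by (rule sum.mono_neutral_cong_right) auto
  also have "\<dots> = of_real (real (N - n) / real N) * cnj w ^ n"
    by simp
  finally show ?thesis .
qed

lemma integral_fejer_kernel_translate:
  assumes "norm w = 1" "N > 0"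
  shows "(LINT z|torus. fejer_kernel N (z * cnj w)) = 1"
proof -
  have "complex_of_real (LINT z|torus. fejer_kernel N (z * cnj w)) =
      fourier_coeff (\<lambda>z. of_real (fejer_kernel N (z * cnj w))) (int 0)"
    by (simp add: fourier_coeff_def)
  also have "\<dots> = 1"
    using fourier_coeff_fejer_kernel_translate[OF assms(1), of N 0] assms(2) by simp
  finally show ?thesis by simp
qed

text \<open>The Cesaro mean of the partial sums over nonnegative frequencies. It is a polynomial,
  and it agrees with the convolution with the Fejer kernel when \<open>f\<close> has no negative
  frequencies.\<close>

definition fejer_mean :: "nat \<Rightarrow> (complex \<Rightarrow> complex) \<Rightarrow> complex poly" where
  "fejer_mean N f = smult (1 / of_nat N)
     (\<Sum>a<N. \<Sum>i\<le>a. monom (fourier_coeff f (int i)) i)"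

lemma coeff_fejer_mean:
  "coeff (fejer_mean N f) n = of_real (real (N - n) / real N) * fourier_coeff f (int n)"
proof -
  have "(\<Sum>a<N. \<Sum>i\<le>a. coeff (monom (fourier_coeff f (int i)) i) n) =
      (\<Sum>a<N. if n \<le> a then fourier_coeff f (int n) else 0)"
    by (intro sum.cong refl) (auto simp: if_distrib cong: if_cong)
  also have "\<dots> = (\<Sum>a\<in>{n..<N}. fourier_coeff f (int n))"
    by (rule sum.mono_neutral_cong_right) auto
  finally show ?thesis by (simp add: fejer_mean_def coeff_sum)
qed

text \<open>Expanding the kernel produces the coefficients of \<open>f\<close> at all differences
  \<open>a - b\<close>. Those with \<open>b > a\<close> vanish, and what remains is the Cesaro
  mean.\<close>

lemma poly_fejer_mean:
  assumes f: "integrable torus f" and analytic: "\<And>n. n < 0 \<Longrightarrow> fourier_coeff f n = 0"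
    and z: "norm z = 1"
  shows "poly (fejer_mean N f) z = (LINT w|torus. f w * of_real (fejer_kernel N (z * cnj w)))"
proof -
  have "(LINT w|torus. f w * of_real (fejer_kernel N (z * cnj w))) =
     (LINT w|torus. (\<Sum>a<N. \<Sum>b<N. z powi (int a - int b) / of_nat N *
       (f w * w powi (- (int a - int b)))))"
  proof (intro Bochner_Integration.integral_cong refl)
    fix w assume "w \<in> space torus"
    then have w: "norm w = 1" by (auto simp: space_torus)
    then have "norm (z * cnj w) = 1" using z by (simp add: norm_mult)
    from fejer_kernel_eq[OF this, of N]
    show "f w * of_real (fejer_kernel N (z * cnj w)) =
      (\<Sum>a<N. \<Sum>b<N. z powi (int a - int b) / of_nat N * (f w * w powi (- (int a - int b))))"
      by (simp only: sum_divide_distrib sum_distrib_left, intro sum.cong refl)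
        (simp add: cnj_eq_inverse[OF w] power_int_mult_distrib power_int_inverse power_int_minus
          del: minus_diff_eq)
  qed
  also have "\<dots> = (\<Sum>a<N. \<Sum>b<N. z powi (int a - int b) / of_nat N * fourier_coeff f (int a - int b))"
    unfolding fourier_coeff_def
    by (simp add: Bochner_Integration.integral_sum integrable_torus_mult_powi[OF f] del: minus_diff_eq)
  also have "\<dots> = (\<Sum>a<N. \<Sum>i\<le>a. z ^ i / of_nat N * fourier_coeff f (int i))"
  proof (rule sum.cong[OF refl])
    fix a assume "a \<in> {..<N}"
    then have "(\<Sum>b<N. z powi (int a - int b) / of_nat N * fourier_coeff f (int a - int b)) =
        (\<Sum>b\<le>a. z ^ (a - b) / of_nat N * fourier_coeff f (int (a - b)))"
      by (intro sum.mono_neutral_cong_right) (auto simp: analytic of_nat_diff power_int_def nat_diff_distrib)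
    also have "\<dots> = (\<Sum>i\<le>a. z ^ i / of_nat N * fourier_coeff f (int i))"
      by (rule sum.reindex_bij_witness[of _ "\<lambda>i. a - i" "\<lambda>i. a - i"]) auto
    finally show "(\<Sum>b<N. z powi (int a - int b) / of_nat N * fourier_coeff f (int a - int b)) =
        (\<Sum>i\<le>a. z ^ i / of_nat N * fourier_coeff f (int i))" .
  qed
  also have "\<dots> = poly (fejer_mean N f) z"
    by (simp add: fejer_mean_def poly_sum poly_monom sum_distrib_left mult_ac)
  finally show ?thesis by simp
qed

text \<open>Convolution with a nonnegative kernel of integral one does not increase the
  \<open>L^1\<close> norm. Working with nonnegative integrals lets the order of integration be
  exchanged without first proving joint integrability.\<close>

lemma L1_norm_fejer_mean_le:
  assumes f: "integrable torus f" and analytic: "\<And>n. n < 0 \<Longrightarrow> fourier_coeff f n = 0"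
    and N: "N > 0"
  shows "(LINT z|torus. norm (poly (fejer_mean N f) z)) \<le> (LINT z|torus. norm (f z))"
proof -
  interpret P: pair_sigma_finite torus torus ..
  have [measurable]: "f \<in> borel_measurable torus" using f by auto
  have K [measurable]: "(\<lambda>(z, w). fejer_kernel N (z * cnj w)) \<in> borel_measurable (torus \<Otimes>\<^sub>M torus)"
  proof -
    have [measurable]: "fejer_kernel N \<in> borel_measurable borel" "cnj \<in> borel_measurable borel"
      by (intro borel_measurable_continuous_onI continuous_intros)+
    have [measurable]: "(\<lambda>z. z) \<in> borel_measurable torus"
      by (intro measurable_torus_continuous continuous_intros)
    show ?thesis by measurable
  qed
  have int_K: "integrable torus (\<lambda>z. fejer_kernel N (z * cnj w))" for w
    by (intro integrable_torus_continuous continuous_intros)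
  have "ennreal (LINT z|torus. norm (poly (fejer_mean N f) z)) =
      (\<integral>\<^sup>+z. ennreal (norm (poly (fejer_mean N f) z)) \<partial>torus)"
    by (intro nn_integral_eq_integral[symmetric] integrable_torus_continuous continuous_intros) auto
  also have "\<dots> \<le> (\<integral>\<^sup>+z. (\<integral>\<^sup>+w. ennreal (norm (f w) * fejer_kernel N (z * cnj w)) \<partial>torus) \<partial>torus)"
  proof (intro nn_integral_mono)
    fix z assume "z \<in> space torus"
    then have z: "norm z = 1" by (simp add: space_torus)
    have int: "integrable torus (\<lambda>w. f w * of_real (fejer_kernel N (z * cnj w)))"
    proof (rule Bochner_Integration.integrable_bound[OF integrable_scaleR_right[OF f, of "real N"]])
      show "(\<lambda>w. f w * of_real (fejer_kernel N (z * cnj w))) \<in> borel_measurable torus"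
      proof -
        have [measurable]: "(\<lambda>w. fejer_kernel N (z * cnj w)) \<in> borel_measurable torus"
          by (intro measurable_torus_continuous continuous_intros)
        show ?thesis by measurable
      qed
      show "AE w in torus. norm (f w * of_real (fejer_kernel N (z * cnj w))) \<le> norm (real N *\<^sub>R f w)"
        using AE_torus_norm
      proof eventually_elim
        case (elim w)
        then have "fejer_kernel N (z * cnj w) \<le> real N"
          by (intro fejer_kernel_le) (simp add: norm_mult z)
        then show ?case
          using mult_right_mono[of "fejer_kernel N (z * cnj w)" "real N" "norm (f w)"]
          by (simp add: norm_mult fejer_kernel_nonneg mult.commute)
      qed
    qed
    have "ennreal (norm (poly (fejer_mean N f) z)) \<le>
        (\<integral>\<^sup>+w. norm (f w * of_real (fejer_kernel N (z * cnj w))) \<partial>torus)"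
      using integral_norm_bound_ennreal[OF int] poly_fejer_mean[OF f analytic z, of N] by simp
    then show "ennreal (norm (poly (fejer_mean N f) z)) \<le>
        (\<integral>\<^sup>+w. ennreal (norm (f w) * fejer_kernel N (z * cnj w)) \<partial>torus)"
      by (simp add: norm_mult fejer_kernel_nonneg)
  qed
  also have "\<dots> = (\<integral>\<^sup>+w. (\<integral>\<^sup>+z. ennreal (norm (f w) * fejer_kernel N (z * cnj w)) \<partial>torus) \<partial>torus)"
    by (rule P.Fubini'[symmetric]) (use K in measurable)
  also have "\<dots> = (\<integral>\<^sup>+w. ennreal (norm (f w)) \<partial>torus)"
  proof (intro nn_integral_cong)
    fix w assume "w \<in> space torus"
    then have w: "norm w = 1" by (simp add: space_torus)
    show "(\<integral>\<^sup>+z. ennreal (norm (f w) * fejer_kernel N (z * cnj w)) \<partial>torus) = ennreal (norm (f w))"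
      by (subst nn_integral_eq_integral)
        (auto simp: int_K fejer_kernel_nonneg integral_fejer_kernel_translate[OF w N])
  qed
  also have "\<dots> = ennreal (LINT z|torus. norm (f z))"
    by (intro nn_integral_eq_integral) (use f in auto)
  finally show ?thesis by (subst (asm) ennreal_le_iff) auto
qed

section \<open>Paley's inequality for integrable functions\<close>

text \<open>The polynomial inequality is applied to a Fejer mean, whose \<open>L^1\<close> norm is
  controlled by that of \<open>f\<close>. One factor 4 comes from the polynomial case, the other
  from coefficients of the mean that are at least half those of \<open>f\<close> in modulus.\<close>

theorem paley_inequality:
  assumes f: "integrable torus f" and analytic: "\<And>n. n < 0 \<Longrightarrow> fourier_coeff f n = 0"
  shows "(\<Sum>k<M. (norm (fourier_coeff f (4 ^ k)))\<^sup>2) \<le> 16 * (LINT z|torus. norm (f z))\<^sup>2"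
proof -
  \<comment> \<open>With this order the Fejer factor \<open>1 - 4 ^ k / N\<close> is at least
    \<open>1/2\<close> for all \<open>k < M\<close>.\<close>
  define N :: nat where "N = 2 * 4 ^ M"
  define p where "p = fejer_mean N f"
  have "N > 0" by (simp add: N_def)
  have "(norm (fourier_coeff f (4 ^ k)))\<^sup>2 \<le> 4 * (norm (coeff p (4 ^ k)))\<^sup>2" if "k < M" for k
  proof -
    have "(4::nat) ^ k \<le> 4 ^ M" using that by (intro power_increasing) auto
    then have "2 * 4 ^ k \<le> N" by (simp add: N_def)
    then have "real N \<le> 2 * real (N - 4 ^ k)" by linarith
    then have "1 / 2 \<le> real (N - 4 ^ k) / real N"
      using \<open>N > 0\<close> by (subst pos_le_divide_eq; linarith)
    then have "1 / 2 * norm (fourier_coeff f (4 ^ k)) \<le>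
        real (N - 4 ^ k) / real N * norm (fourier_coeff f (4 ^ k))"
      by (rule mult_right_mono) (rule norm_ge_zero)
    also have "\<dots> = norm (coeff p (4 ^ k))"
      unfolding p_def coeff_fejer_mean norm_mult norm_of_real by simp
    finally have "norm (fourier_coeff f (4 ^ k)) \<le> 2 * norm (coeff p (4 ^ k))" by simp
    then have "(norm (fourier_coeff f (4 ^ k)))\<^sup>2 \<le> (2 * norm (coeff p (4 ^ k)))\<^sup>2"
      by (intro power_mono) auto
    then show ?thesis by (simp add: power_mult_distrib)
  qed
  then have "(\<Sum>k<M. (norm (fourier_coeff f (4 ^ k)))\<^sup>2) \<le> (\<Sum>k<M. 4 * (norm (coeff p (4 ^ k)))\<^sup>2)"
    by (intro sum_mono) auto
  also have "\<dots> = 4 * (\<Sum>k<M. (norm (coeff p (4 ^ k)))\<^sup>2)"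
    by (simp add: sum_distrib_left)
  also have "\<dots> \<le> 4 * (4 * (LINT z|torus. norm (poly p z))\<^sup>2)"
    by (intro mult_left_mono paley_poly) auto
  also have "\<dots> \<le> 4 * (4 * (LINT z|torus. norm (f z))\<^sup>2)"
    unfolding p_def using L1_norm_fejer_mean_le[OF assms \<open>N > 0\<close>]
    by (intro mult_left_mono power_mono) auto
  finally show ?thesis by simp
qed

section \<open>Failure below the exponent one half\<close>

definition lacunary_multiplier :: "int \<Rightarrow> complex" where
  "lacunary_multiplier = indicator (range (\<lambda>k::nat. 4 ^ k))"

lemma summable_on_lacunary_multiplier_iff:
  "(\<lambda>n. (norm (lacunary_multiplier n * c n))\<^sup>2) summable_on UNIV \<longleftrightarrow>
    summable (\<lambda>k. (norm (c (4 ^ k)))\<^sup>2)"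
proof -
  have inj: "inj (\<lambda>k::nat. 4 ^ k :: int)"
    by (auto simp: inj_def)
  have "(\<lambda>n. (norm (lacunary_multiplier n * c n))\<^sup>2) summable_on UNIV \<longleftrightarrow>
      (\<lambda>n. (norm (c n))\<^sup>2) summable_on range (\<lambda>k::nat. 4 ^ k)"
    by (rule summable_on_cong_neutral) (auto simp: lacunary_multiplier_def indicator_def)
  also have "\<dots> \<longleftrightarrow> (\<lambda>k::nat. (norm (c (4 ^ k)))\<^sup>2) summable_on UNIV"
    using summable_on_reindex[OF inj, of "\<lambda>n. (norm (c n))\<^sup>2"] by (simp add: o_def)
  also have "\<dots> \<longleftrightarrow> summable (\<lambda>k. (norm (c (4 ^ k)))\<^sup>2)"
    by (rule summable_on_UNIV_nonneg_real_iff) simp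
  finally show ?thesis .
qed

lemma L2_multiplier_lacunary_iff:
  "L2_multiplier X lacunary_multiplier \<longleftrightarrow>
    (\<forall>f\<in>X. summable (\<lambda>k. (norm (fourier_coeff f (4 ^ k)))\<^sup>2))"
proof -
  have "bounded (range lacunary_multiplier)"
    by (intro boundedI[of _ 1]) (auto simp: lacunary_multiplier_def indicator_def)
  then show ?thesis
    by (simp add: L2_multiplier_def summable_on_lacunary_multiplier_iff)
qed

text \<open>Adding \<open>\<i>\<close> times the Hilbert transform multiplies the coefficients by
  \<open>1 + sgn n\<close>: negative frequencies disappear and positive ones are doubled. Paley's
  inequality for the resulting \<open>F\<close> then bounds all partial sums uniformly in
  \<open>M\<close>.\<close>

lemma L2_multiplier_hardy_H1_lacunary: "L2_multiplier hardy_H1 lacunary_multiplier"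
  unfolding L2_multiplier_lacunary_iff
proof
  fix f assume "f \<in> hardy_H1"
  then obtain g where f: "integrable torus f" and g: "integrable torus g"
      and H: "is_hilbert_transform f g"
    by (auto simp: hardy_H1_def L1_torus_def)
  define F where "F z = f z + \<i> * g z" for z
  have F: "integrable torus F"
    unfolding F_def using f g by auto
  have coeff: "fourier_coeff F n = (1 + of_int (sgn n)) * fourier_coeff f n" for n
  proof -
    have "fourier_coeff F n = fourier_coeff f n + \<i> * fourier_coeff g n"
      unfolding F_def by (rule fourier_coeff_add_mult[OF f g])
    also have "\<dots> = (1 + of_int (sgn n)) * fourier_coeff f n"
      using H by (simp add: is_hilbert_transform_def algebra_simps)
    finally show ?thesis .
  qed
  have "fourier_coeff F n = 0" if "n < 0" for n
    using that by (simp add: coeff)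
  note paley_inequality[OF F this]
  then have "(\<Sum>k<M. (norm (fourier_coeff F (4 ^ k)))\<^sup>2) \<le> 16 * (LINT z|torus. norm (F z))\<^sup>2" for M
    by simp
  then have "summable (\<lambda>k. (norm (fourier_coeff F (4 ^ k)))\<^sup>2)"
    by (intro summableI_nonneg_bounded) auto
  \<comment> \<open>Dividing by 4 undoes the doubling, as the frequencies \<open>4 ^ k\<close> are
    positive.\<close>
  then have "summable (\<lambda>k. (norm (fourier_coeff F (4 ^ k)))\<^sup>2 / 4)"
    by (rule summable_divide)
  then show "summable (\<lambda>k. (norm (fourier_coeff f (4 ^ k)))\<^sup>2)"
    by (simp add: coeff norm_mult power_mult_distrib)
qed

section \<open>Pointwise logarithmic estimates\<close>

text \<open>The factor \<open>1/2\<close> on the right allows absorption when this is averaged over \<open>a\<close> with mean \<open>b\<close>.\<close>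

lemma mult_ln_powr_le:
  fixes a b r :: real
  assumes "a \<ge> 0" "b \<ge> 0" "r \<ge> 0"
  shows "a * ln (1 + b) powr r \<le> a * ln (1 + 2 * a) powr r + b / 2 * ln (1 + b) powr r"
proof (cases "b \<le> 2 * a")
  case True
  then have "a * ln (1 + b) powr r \<le> a * ln (1 + 2 * a) powr r"
    using assms by (intro mult_left_mono powr_mono2) auto
  moreover have "0 \<le> b / 2 * ln (1 + b) powr r" using assms by simp
  ultimately show ?thesis by linarith
next
  case False
  then have "a * ln (1 + b) powr r \<le> b / 2 * ln (1 + b) powr r"
    by (intro mult_right_mono) auto
  moreover have "0 \<le> a * ln (1 + 2 * a) powr r" using assms by simp
  ultimately show ?thesis by linarith
qed

text \<open>A substitute for Jensen's inequality: with \<open>ln (1 + u) powr r\<close> held fixed,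
  the preceding inequality is averaged over \<open>a = h j\<close> with \<open>b = u\<close>. Half
  of the left-hand side reappears on the right and is absorbed, which gives the factor 2.\<close>

lemma weighted_sum_LlogL_bound:
  fixes w h k :: "nat \<Rightarrow> real"
  assumes w: "w sums 1" "\<And>j. w j \<ge> 0" and h: "\<And>j. h j \<ge> 0"
    and hk: "\<And>j. h j * ln (1 + 2 * h j) powr r \<le> C * k j"
    and sum_h: "(\<lambda>j. w j * h j) sums u" and sum_k: "(\<lambda>j. w j * k j) sums s" and r: "r \<ge> 0"
  shows "u * ln (1 + u) powr r \<le> 2 * C * s"
proof -
  have u: "u \<ge> 0"
    using sums_le[OF _ sums_zero sum_h] w(2) h by simp
  let ?L = "ln (1 + u) powr r"
  have "w j * h j * ?L \<le> C * (w j * k j) + w j * (u / 2 * ?L)" for j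
  proof -
    have "h j * ?L \<le> C * k j + u / 2 * ?L"
      using mult_ln_powr_le[OF h[of j] u r] hk[of j] by linarith
    then have "w j * (h j * ?L) \<le> w j * (C * k j + u / 2 * ?L)"
      by (rule mult_left_mono) (rule w)
    then show ?thesis by (simp add: algebra_simps)
  qed
  moreover have "(\<lambda>j. w j * h j * ?L) sums (u * ?L)"
    by (intro sums_mult2 sum_h)
  moreover have "(\<lambda>j. C * (w j * k j) + w j * (u / 2 * ?L)) sums (C * s + 1 * (u / 2 * ?L))"
    by (intro sums_add sums_mult sums_mult2 sum_k w)
  ultimately have "u * ?L \<le> C * s + 1 * (u / 2 * ?L)"
    by (rule sums_le)
  then show ?thesis by simp
qed

text \<open>A kernel of order \<open>2 * 4 ^ N\<close> is bounded by its order, so its logarithm is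
  at most a multiple of \<open>N\<close>, and the damping \<open>N powr (- r)\<close> cancels the
  power of the logarithm.\<close>

lemma fejer_kernel_ln_bound:
  assumes z: "norm z = 1" and N: "N \<ge> 1" and r: "r \<ge> 0"
  defines "K \<equiv> fejer_kernel (2 * 4 ^ N) z"
  defines "h \<equiv> real N powr (- r) * K"
  shows "h * ln (1 + 2 * h) powr r \<le> 6 powr r * K"
proof -
  have K: "0 \<le> K" "K \<le> 2 * 4 ^ N"
    using fejer_kernel_le[OF z, of "2 * 4 ^ N"] by (simp_all add: K_def fejer_kernel_nonneg)
  have "real N powr (- r) \<le> 1"
    using N r by (simp add: powr_minus inverse_le_1_iff ge_one_powr_ge_zero)
  then have h: "0 \<le> h" "h \<le> K"
    using K by (auto simp: h_def intro: mult_left_le_one_le)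
  have "(1::real) \<le> 4 ^ N" by simp
  moreover have "(4::real) ^ (N + 2) = 16 * 4 ^ N" by simp
  ultimately have "1 + 2 * h \<le> 4 ^ (N + 2)"
    using h K by linarith
  then have "ln (1 + 2 * h) \<le> ln (4 ^ (N + 2))"
    using h by (intro ln_mono) auto
  also have "\<dots> = real (N + 2) * ln 4"
    by (rule ln_realpow)
  also have "\<dots> \<le> real (N + 2) * 2"
  proof -
    have "ln (4::real) = 2 * ln 2" using ln_realpow[of 2 2] by simp
    moreover have "ln (2::real) \<le> 1" using ln_le_minus_one[of 2] by simp
    ultimately show ?thesis by (intro mult_left_mono) auto
  qed
  \<comment> \<open>The constant 6 comes from \<open>2 * (N + 2) \<le> 6 * N\<close>, valid for
    \<open>N \<ge> 1\<close>.\<close>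
  also have "\<dots> \<le> 6 * real N" using N by simp
  finally have "ln (1 + 2 * h) powr r \<le> (6 * real N) powr r"
    using h r by (intro powr_mono2) auto
  then have "h * ln (1 + 2 * h) powr r \<le> h * (6 * real N) powr r"
    using h by (intro mult_left_mono) auto
  also have "\<dots> = 6 powr r * K"
    using N by (simp add: h_def powr_mult powr_minus)
  finally show ?thesis .
qed

lemma fourier_coeff_fejer_kernel:
  "fourier_coeff (\<lambda>z. of_real (fejer_kernel N z)) (int n) = of_real (real (N - n) / real N)"
  using fourier_coeff_fejer_kernel_translate[of 1 N n] by simp

lemma integral_fejer_kernel: "N > 0 \<Longrightarrow> (LINT z|torus. fejer_kernel N z) = 1"
  using integral_fejer_kernel_translate[of 1 N] by simp

lemma integrable_fejer_kernel: "integrable torus (fejer_kernel N)"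
  by (intro integrable_torus_continuous continuous_intros)

section \<open>The superposition of damped Fejer kernels\<close>

text \<open>The orders \<open>N j\<close> stay free here; their rapid growth is imposed only in the
  final argument. The bound \<open>N j \<ge> 1\<close> keeps the damping factors at most 1.\<close>

locale fejer_series =
  fixes r :: real and N :: "nat \<Rightarrow> nat"
  assumes r: "r \<ge> 0" and N: "\<And>j. N j \<ge> 1"
begin

definition kernel :: "nat \<Rightarrow> complex \<Rightarrow> real" where
  "kernel j = fejer_kernel (2 * 4 ^ N j)"

definition weight :: "nat \<Rightarrow> real" where
  "weight j = (1 / 2) ^ Suc j"

text \<open>Where the series diverges its value is unspecified. This can happen only on a null set,
  by \<open>AE_summable_kernel\<close> and \<open>summable_damped\<close>.\<close>

definition series :: "complex \<Rightarrow> real" where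
  "series z = (\<Sum>j. weight j * (real (N j) powr (- r) * kernel j z))"

lemma weight_sums: "weight sums 1"
  unfolding weight_def by (rule power_half_series)

lemma weight_pos: "weight j > 0"
  by (simp add: weight_def)

lemma kernel_nonneg: "kernel j z \<ge> 0"
  by (simp add: kernel_def fejer_kernel_nonneg)

lemma measurable_kernel [measurable]: "kernel j \<in> borel_measurable torus"
  unfolding kernel_def using integrable_fejer_kernel by auto

lemma integrable_kernel: "integrable torus (kernel j)"
  unfolding kernel_def by (rule integrable_fejer_kernel)

lemma integral_kernel: "(LINT z|torus. kernel j z) = 1"
  unfolding kernel_def by (rule integral_fejer_kernel) simp

lemma damping: "0 \<le> real (N j) powr (- r)" "real (N j) powr (- r) \<le> 1"
  using N[of j] r by (auto simp: powr_minus inverse_le_1_iff ge_one_powr_ge_zero)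

text \<open>Each kernel has integral one and the weights sum to one, so the sum of these nonnegative
  functions has integral one and is finite almost everywhere.\<close>

lemma AE_summable_kernel: "AE z in torus. summable (\<lambda>j. weight j * kernel j z)"
proof -
  have "(\<integral>\<^sup>+z. (\<Sum>j. ennreal (weight j * kernel j z)) \<partial>torus) =
      (\<Sum>j. \<integral>\<^sup>+z. ennreal (weight j * kernel j z) \<partial>torus)"
    by (rule nn_integral_suminf) measurable
  also have "\<dots> = (\<Sum>j. ennreal (weight j))"
    by (intro suminf_cong, subst nn_integral_eq_integral)
      (auto simp: integrable_kernel integral_kernel kernel_nonneg less_imp_le[OF weight_pos])
  also have "\<dots> = ennreal 1"
    using weight_sums weight_pos by (intro suminf_ennreal_eq less_imp_le)
  finally have "(\<integral>\<^sup>+z. (\<Sum>j. ennreal (weight j * kernel j z)) \<partial>torus) \<noteq> \<infinity>"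
    by simp
  then have "AE z in torus. (\<Sum>j. ennreal (weight j * kernel j z)) \<noteq> \<infinity>"
    by (intro nn_integral_PInf_AE) measurable
  then show ?thesis
    by eventually_elim
      (auto intro!: summable_suminf_not_top simp: kernel_nonneg less_imp_le[OF weight_pos])
qed

lemma summable_damped:
  assumes "summable (\<lambda>j. weight j * kernel j z)"
  shows "summable (\<lambda>j. weight j * (real (N j) powr (- r) * kernel j z))"
  using assms
  by (rule summable_comparison_test'[where N = 0])
    (auto simp: abs_mult kernel_nonneg less_imp_le[OF weight_pos] damping
      intro!: mult_left_mono mult_left_le_one_le)

lemma measurable_series: "series \<in> borel_measurable torus"
  unfolding series_def by measurable

lemma series_in_LlogL: "(\<lambda>z. of_real (series z)) \<in> LlogL r"
proof -
  \<comment> \<open>The undamped superposition is integrable and, up to a constant, majorises the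
    \<open>L log^r L\<close> integrand of \<open>series\<close>.\<close>
  define S where "S z = (\<Sum>j. weight j * kernel j z)" for z
  have "integrable torus S"
    unfolding S_def
  proof (rule integrable_suminf)
    show "AE z in torus. summable (\<lambda>j. norm (weight j * kernel j z))"
      using AE_summable_kernel
      by eventually_elim (simp add: abs_mult kernel_nonneg less_imp_le[OF weight_pos])
    show "summable (\<lambda>j. LINT z|torus. norm (weight j * kernel j z))"
      using weight_sums
      by (simp add: abs_mult kernel_nonneg less_imp_le[OF weight_pos] integral_kernel sums_iff)
  qed (simp add: integrable_kernel)
  then have "integrable torus (\<lambda>z. 2 * 6 powr r * S z)" by simp
  then have "integrable torus (\<lambda>z. norm (series z) * ln (1 + norm (series z)) powr r)"
  proof (rule Bochner_Integration.integrable_bound)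
    show "(\<lambda>z. norm (series z) * ln (1 + norm (series z)) powr r) \<in> borel_measurable torus"
      using measurable_series by measurable
    show "AE z in torus. norm (norm (series z) * ln (1 + norm (series z)) powr r) \<le>
        norm (2 * 6 powr r * S z)"
      using AE_summable_kernel AE_torus_norm
    proof eventually_elim
      case (elim z)
      have sums: "(\<lambda>j. weight j * (real (N j) powr (- r) * kernel j z)) sums series z"
        unfolding series_def by (intro summable_sums summable_damped elim)
      then have "series z \<ge> 0"
        using sums_le[OF _ sums_zero sums] weight_pos kernel_nonneg by (simp add: less_imp_le)
      moreover have "series z * ln (1 + series z) powr r \<le> 2 * 6 powr r * S z"
      proof (rule weighted_sum_LlogL_bound[OF weight_sums])
        show "(\<lambda>j. weight j * kernel j z) sums S z"
          unfolding S_def by (intro summable_sums elim)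
        show "real (N j) powr (- r) * kernel j z *
            ln (1 + 2 * (real (N j) powr (- r) * kernel j z)) powr r \<le> 6 powr r * kernel j z" for j
          unfolding kernel_def by (rule fejer_kernel_ln_bound[OF elim(2) N r])
      qed (auto simp: sums r kernel_nonneg less_imp_le[OF weight_pos])
      ultimately show ?case by simp
    qed
  qed
  then show ?thesis
    using measurable_series by (simp add: LlogL_def)
qed

text \<open>Fejer kernels have nonnegative coefficients at the frequencies \<open>4 ^ k\<close>, so
  nothing cancels and all terms but the \<open>j\<close>-th may be dropped. For
  \<open>k \<le> N j\<close> the \<open>j\<close>-th kernel has coefficient at least
  \<open>1/2\<close> there.\<close>

lemma fourier_coeff_series_ge:
  assumes "k \<le> N j"
  shows "weight j * (real (N j) powr (- r) / 2) \<le> norm (fourier_coeff (\<lambda>z. of_real (series z)) (4 ^ k))"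
proof -
  let ?w = "\<lambda>i. weight i * real (N i) powr (- r)"
  define q where "q i = real (2 * 4 ^ N i - 4 ^ k) / real (2 * 4 ^ N i)" for i
  define t where "t i z = of_real (?w i) * (of_real (kernel i z) * z powi (- (4 ^ k)))" for i z
  have t_int: "integrable torus (t i)" for i
    unfolding t_def
    by (intro integrable_mult_right integrable_torus_mult_powi integrable_of_real integrable_kernel)
  have norm_t: "norm (t i z) = weight i * (real (N i) powr (- r) * kernel i z)" if "norm z = 1" for i z
    using that by (simp add: t_def norm_mult norm_power_int kernel_nonneg weight_pos less_imp_le)
  have "(\<lambda>i. LINT z|torus. t i z) sums (LINT z|torus. (\<Sum>i. t i z))"
  proof (rule sums_integral[OF t_int])
    show "AE z in torus. summable (\<lambda>i. norm (t i z))"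
      using AE_summable_kernel AE_torus_norm
      by eventually_elim (simp add: norm_t summable_damped)
    have "(LINT z|torus. norm (t i z)) = weight i * real (N i) powr (- r)" for i
    proof -
      have "(LINT z|torus. norm (t i z)) = (LINT z|torus. ?w i * kernel i z)"
        by (intro Bochner_Integration.integral_cong) (auto simp: space_torus norm_t)
      then show ?thesis by (simp add: integral_kernel)
    qed
    moreover have "summable ?w"
      by (rule summable_comparison_test'[where N = 0, OF sums_summable[OF weight_sums]])
        (auto simp: abs_mult weight_pos less_imp_le damping mult_left_le)
    ultimately show "summable (\<lambda>i. LINT z|torus. norm (t i z))" by simp
  qed
  also have "(LINT z|torus. (\<Sum>i. t i z)) = fourier_coeff (\<lambda>z. of_real (series z)) (4 ^ k)"
    unfolding fourier_coeff_def
  proof (rule integral_cong_AE)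
    show "(\<lambda>z. \<Sum>i. t i z) \<in> borel_measurable torus"
      using t_int by (intro borel_measurable_suminf) auto
    have "(\<lambda>z::complex. z powi (- (4 ^ k))) \<in> borel_measurable torus"
      by (intro measurable_torus_continuous continuous_intros) auto
    then show "(\<lambda>z. of_real (series z) * z powi (- (4 ^ k))) \<in> borel_measurable torus"
      using measurable_series by measurable
    show "AE z in torus. (\<Sum>i. t i z) = of_real (series z) * z powi (- (4 ^ k))"
      using AE_summable_kernel
    proof eventually_elim
      case (elim z)
      have "(\<lambda>i. weight i * (real (N i) powr (- r) * kernel i z)) sums series z"
        unfolding series_def by (intro summable_sums summable_damped elim)
      then have "(\<lambda>i. complex_of_real (weight i * (real (N i) powr (- r) * kernel i z)) *
          z powi (- (4 ^ k))) sums (of_real (series z) * z powi (- (4 ^ k)))"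
        by (intro sums_mult2 sums_of_real)
      then show ?case by (simp add: t_def sums_iff mult.assoc)
    qed
  qed
  finally have sums: "(\<lambda>i. LINT z|torus. t i z) sums fourier_coeff (\<lambda>z. of_real (series z)) (4 ^ k)" .
  have "(LINT z|torus. t i z) = of_real (?w i * q i)" for i
    using fourier_coeff_fejer_kernel[of "2 * 4 ^ N i" "4 ^ k"]
    unfolding t_def q_def fourier_coeff_def kernel_def by simp
  with sums have sums': "(\<lambda>i. complex_of_real (?w i * q i)) sums fourier_coeff (\<lambda>z. of_real (series z)) (4 ^ k)"
    by simp
  have q: "q i \<ge> 0" for i by (simp add: q_def)
  \<comment> \<open>The terms are real, so the real part carries the whole sum and can be bounded
    below termwise.\<close>
  have summ: "(\<lambda>i. ?w i * q i) sums Re (fourier_coeff (\<lambda>z. of_real (series z)) (4 ^ k))"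
    using sums_Re[OF sums'] by simp
  have "(4::nat) ^ k \<le> 4 ^ N j" using assms by (intro power_increasing) auto
  then have "real (2 * 4 ^ N j) \<le> 2 * real (2 * 4 ^ N j - 4 ^ k)" by linarith
  then have "1 / 2 \<le> q j"
    unfolding q_def by (simp add: field_simps)
  then have "?w j * (1 / 2) \<le> ?w j * q j"
    using weight_pos[of j] by (intro mult_left_mono) auto
  also have "\<dots> = (\<Sum>i\<in>{j}. ?w i * q i)" by simp
  also have "\<dots> \<le> (\<Sum>i. ?w i * q i)"
    using summ q weight_pos by (intro sum_le_suminf) (auto simp: sums_iff less_imp_le)
  also have "\<dots> = Re (fourier_coeff (\<lambda>z. of_real (series z)) (4 ^ k))"
    using summ by (simp add: sums_iff)
  also have "\<dots> \<le> norm (fourier_coeff (\<lambda>z. of_real (series z)) (4 ^ k))"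
    by (rule complex_Re_le_cmod)
  finally show ?thesis by simp
qed

end

section \<open>Divergence of the squared lacunary coefficients\<close>

lemma not_L2_multiplier_LlogL_lacunary:
  assumes r: "0 \<le> r" "r < 1 / 2"
  shows "\<not> L2_multiplier (LlogL r) lacunary_multiplier"
proof
  assume mult: "L2_multiplier (LlogL r) lacunary_multiplier"
  \<comment> \<open>The exponent \<open>1 - 2 * r\<close> is positive because
    \<open>r < 1/2\<close>. The growth \<open>8 ^ j\<close> is chosen to outweigh the squared
    weights, which decay like \<open>4 ^ (- j)\<close>, and leaves \<open>2 ^ j\<close>.\<close>
  have "\<exists>n\<ge>1. 8 ^ j \<le> real n powr (1 - 2 * r)" for j :: nat
  proof -
    have "filterlim (\<lambda>n. real n powr (1 - 2 * r)) at_top sequentially"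
      using r by real_asymp
    then have "\<forall>\<^sub>F n in sequentially. 8 ^ j \<le> real n powr (1 - 2 * r)"
      by (simp add: filterlim_at_top)
    then have "\<forall>\<^sub>F n in sequentially. n \<ge> 1 \<and> 8 ^ j \<le> real n powr (1 - 2 * r)"
      using eventually_ge_at_top[of "1::nat"] by eventually_elim simp
    then show ?thesis
      by (auto simp: eventually_sequentially)
  qed
  then obtain N where N_ge_1: "\<And>j. N j \<ge> 1" and N_large: "\<And>j. 8 ^ j \<le> real (N j) powr (1 - 2 * r)"
    by metis
  interpret fejer_series r N
    using r N_ge_1 by unfold_locales auto
  define c where "c k = (norm (fourier_coeff (\<lambda>z. of_real (series z)) (4 ^ k)))\<^sup>2" for k
  have summ: "summable c"
    using mult series_in_LlogL unfolding L2_multiplier_lacunary_iff c_def by blast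
  have "2 ^ j \<le> 16 * suminf c" for j :: nat
  proof -
    let ?x = "weight j * (real (N j) powr (- r) / 2)"
    have "(2::real) ^ j / 16 = (weight j)\<^sup>2 / 4 * 8 ^ j"
    proof -
      have "(8::real) ^ j = 2 ^ j * (2 ^ j * 2 ^ j)"
        by (simp flip: power_mult_distrib)
      then show ?thesis by (simp add: weight_def power2_eq_square power_divide)
    qed
    also have "\<dots> \<le> (weight j)\<^sup>2 / 4 * real (N j) powr (1 - 2 * r)"
      by (intro mult_left_mono N_large) auto
    also have "real (N j) powr (1 - 2 * r) = real (N j) * (real (N j) powr (- r))\<^sup>2"
      using N_ge_1[of j]
      by (simp add: powr_diff powr_minus power2_eq_square powr_add[symmetric] divide_inverse
          flip: inverse_mult_distrib)
    \<comment> \<open>The same lower bound holds at each of the \<open>N j\<close> frequencies with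
      \<open>k < N j\<close>; hence the factor \<open>N j\<close>.\<close>
    also have "(weight j)\<^sup>2 / 4 * (real (N j) * (real (N j) powr (- r))\<^sup>2) = (\<Sum>k<N j. ?x\<^sup>2)"
      by (simp add: power_mult_distrib power_divide)
    also have "\<dots> \<le> (\<Sum>k<N j. c k)"
      unfolding c_def using weight_pos[of j]
      by (intro sum_mono power_mono fourier_coeff_series_ge) auto
    also have "\<dots> \<le> suminf c"
      by (intro sum_le_suminf summ) (auto simp: c_def)
    finally show ?thesis by simp
  qed
  moreover obtain j where "16 * suminf c < 2 ^ j"
    using real_arch_pow[of 2 "16 * suminf c"] by auto
  ultimately show False using not_less by blast
qed

theorem mainTheorem2:
  fixes r :: real
  assumes "r \<ge> 0"
    and "\<And>m. L2_multiplier hardy_H1 m \<Longrightarrow> L2_multiplier (LlogL r) m"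
  shows "r \<ge> 1 / 2"
  using assms(2)[OF L2_multiplier_hardy_H1_lacunary] not_L2_multiplier_LlogL_lacunary[OF assms(1)]
  by linarith

end
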